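(* Let $A$ be a nontrivial $C^{*}$-algebra (i.e. $\dim A>1$). Then: (1) There are nonzero positive elements $a$ and $b$ in $A$ such that $ab=ba=0$. (2) If $a\in A$ is a positive element and $0\le a\le b$ for some zero divisor $b\in A$, then $a$ is a zero divisor. (3) If $A$ is commutative and separable, then there is a positive element in $A$ which is not a zero divisor.
   Context: A $C^{*}$-algebra (complex, not necessarily unital) is called nontrivial if $\dim A>1$. An element $x\in A$ is positive if $x=yy^{*}$ for some $y\in A$, and $a\le b$ means $b-a$ is positive. An element $x\in A$ is called a zero divisor if there is a nonzero $y\in A$ with $xy=0$ or $yx=0$ (with this convention $0$ is a zero divisor in a nonzero algebra). *)

theory Defs
  imports "HOL-Analysis.Analysis"
begin

class complex_vector = real_vector +
  fixes scaleC :: "complex \<Rightarrow> 'a \<Rightarrow> 'a"  (infixr \<open>*\<^sub>C\<close> 75)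
  assumes scaleC_add_right: "c *\<^sub>C (x + y) = c *\<^sub>C x + c *\<^sub>C y"
    and scaleC_add_left: "(c + d) *\<^sub>C x = c *\<^sub>C x + d *\<^sub>C x"
    and scaleC_scaleC: "c *\<^sub>C d *\<^sub>C x = (c * d) *\<^sub>C x"
    and scaleC_one: "1 *\<^sub>C x = x"
    and scaleC_of_real: "complex_of_real r *\<^sub>C x = r *\<^sub>R x"

global_interpretation complex_vector: vector_space "scaleC :: complex \<Rightarrow> 'a \<Rightarrow> 'a :: complex_vector"
  by unfold_locales (simp_all add: scaleC_add_right scaleC_add_left scaleC_scaleC scaleC_one)

text \<open>
  The multiplication need not have a unit: the class \<^class>\<open>real_normed_algebra\<close>
  does not assume one.
\<close>

class cstar_algebra = complex_vector + real_normed_algebra + banach +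
  fixes star :: "'a \<Rightarrow> 'a"
  assumes mult_scaleC_left: "(c *\<^sub>C x) * y = c *\<^sub>C (x * y)"
    and mult_scaleC_right: "x * (c *\<^sub>C y) = c *\<^sub>C (x * y)"
    and norm_scaleC: "norm (c *\<^sub>C x) = cmod c * norm x"
    and star_star: "star (star x) = x"
    and star_add: "star (x + y) = star x + star y"
    and star_scaleC: "star (c *\<^sub>C x) = cnj c *\<^sub>C star x"
    and star_mult: "star (x * y) = star y * star x"
    and cstar_identity: "norm (star x * x) = (norm x)\<^sup>2"

text \<open>
  The complex dimension of the algebra exceeds 1. Infinite bases are listed
  separately, because both \<^const>\<open>card\<close> and the library's \<open>dim\<close> are 0 in
  the infinite-dimensional case.
\<close>

definition nontrivial :: "'a :: cstar_algebra itself \<Rightarrow> bool" where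
  "nontrivial _ \<longleftrightarrow>
     (\<exists>B :: 'a set. complex_vector.independent B \<and> complex_vector.span B = UNIV
        \<and> (infinite B \<or> card B > 1))"

definition positive_element :: "'a :: cstar_algebra \<Rightarrow> bool" where
  "positive_element x \<longleftrightarrow> (\<exists>y. x = y * star y)"

definition cstar_le :: "'a :: cstar_algebra \<Rightarrow> 'a \<Rightarrow> bool"  (infix \<open>\<preceq>\<close> 50) where
  "a \<preceq> b \<longleftrightarrow> positive_element (b - a)"

definition zero_divisor :: "'a :: cstar_algebra \<Rightarrow> bool" where
  "zero_divisor x \<longleftrightarrow> (\<exists>y. y \<noteq> 0 \<and> (x * y = 0 \<or> y * x = 0))"

end

theory Submission
  imports Defs
begin

text \<open>
  In the unitization, call a selfadjoint \<open>a\<close> nonnegative if \<open>norm (t - a) \<le> t\<close> for some real \<open>t\<close>. This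
  defines a closed convex cone. It coincides with the set of squares of selfadjoint elements, because
  \<open>1 - k\<close> has a square root when \<open>norm k \<le> 1\<close>, and because \<open>s + i r\<close> with \<open>r\<^sup>2 = 1 - s\<^sup>2\<close> is unitary.
  No spectral theory is needed: the remaining positivity claims (for the two parts of a selfadjoint
  element, and for \<open>x\<^sup>* x\<close> as soon as \<open>x x\<^sup>*\<close> is nonnegative) follow from power bounds on
  \<open>a (t - a)\<^sup>j\<close>, and Kaplansky's argument then shows that every \<open>x\<^sup>* x\<close> is nonnegative.

  So the positive elements form a closed proper cone. (1) If no selfadjoint element had two nonzero
  orthogonal parts, this cone would order the selfadjoint elements totally, and connectedness of the
  real line would make them all multiples of one of them. (2) If \<open>b y = 0\<close> and \<open>x x\<^sup>* \<le> b = x x\<^sup>* + z z\<^sup>*\<close>,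
  then \<open>(x\<^sup>* y)\<^sup>* (x\<^sup>* y) = - (z\<^sup>* y)\<^sup>* (z\<^sup>* y)\<close>, so both vanish. (3) Sum up scaled \<open>x\<^sub>n x\<^sub>n\<^sup>*\<close> over a dense
  sequence and apply (2).
\<close>

section \<open>The involution\<close>

lemma scaleC_minus_one: "(-1) *\<^sub>C x = - (x :: 'a :: complex_vector)"
  using scaleC_of_real[of "-1" x] by simp

lemma star_minus: "star (- x) = - star (x :: 'a :: cstar_algebra)"
  using star_scaleC[of "-1" x] by (simp add: scaleC_minus_one)

lemma star_diff: "star (x - y) = star x - star (y :: 'a :: cstar_algebra)"
  using star_add[of x "- y"] by (simp add: star_minus)

lemma star_zero [simp]: "star (0 :: 'a :: cstar_algebra) = 0"
  using star_diff[of 0 "0 :: 'a"] by simp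

lemma star_scaleR: "star (r *\<^sub>R x) = r *\<^sub>R star (x :: 'a :: cstar_algebra)"
  using star_scaleC[of "of_real r" x] by (simp add: scaleC_of_real)

lemma star_mult_self_eq_0_iff [simp]: "star x * x = 0 \<longleftrightarrow> (x :: 'a :: cstar_algebra) = 0"
  using cstar_identity[of x] by auto

text \<open>The C*-identity gives \<open>(norm y)\<^sup>2 \<le> norm (star y) * norm y\<close>;
  cancelling \<open>norm y\<close> for \<open>y = x\<close> and for \<open>y = star x\<close> gives
  both inequalities.\<close>

lemma norm_star [simp]: "norm (star x) = norm (x :: 'a :: cstar_algebra)"
proof -
  have le: "norm y \<le> norm (star y)" for y :: 'a
  proof (cases "y = 0")
    case False
    have "(norm y)\<^sup>2 \<le> norm (star y) * norm y"
      using norm_mult_ineq[of "star y" y] by (simp add: cstar_identity)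
    then show ?thesis
      using False by (simp add: power2_eq_square)
  qed simp
  show ?thesis
    using le[of x] le[of "star x"] by (simp add: star_star)
qed

lemma norm_selfadjoint_square:
  "star x = x \<Longrightarrow> norm (x * x) = (norm (x :: 'a :: cstar_algebra))\<^sup>2"
  using cstar_identity[of x] by simp

lemma bounded_linear_star: "bounded_linear (star :: 'a :: cstar_algebra \<Rightarrow> 'a)"
  by (rule bounded_linear_intro[where K = 1]) (simp_all add: star_add star_scaleR)

lemma closed_selfadjoint: "closed {x :: 'a :: cstar_algebra. star x = x}"
  using bounded_linear.continuous_on[OF bounded_linear_star continuous_on_id]
  by (intro closed_Collect_eq) (auto intro: continuous_intros)

lemma selfadjoint_decomposition:
  obtains a b :: "'a :: cstar_algebra"
  where "star a = a" "star b = b" "x = a + \<i> *\<^sub>C b"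
proof
  let ?a = "(1/2) *\<^sub>C (x + star x)" and ?b = "(-\<i>/2) *\<^sub>C (x - star x)"
  show "star ?a = ?a"
    by (simp add: star_scaleC star_add star_star add.commute)
  have "star ?b = (\<i>/2) *\<^sub>C (star x - x)"
    by (simp add: star_minus star_scaleC star_diff star_star)
  also have "\<dots> = ?b"
    by (simp add: complex_vector.scale_right_diff_distrib)
  finally show "star ?b = ?b" .
  have "\<i> *\<^sub>C ?b = (1/2) *\<^sub>C (x - star x)"
    by (simp add: scaleC_scaleC)
  then have "?a + \<i> *\<^sub>C ?b = (1/2) *\<^sub>C (x + x)"
    by (simp flip: scaleC_add_right)
  also have "x + x = 2 *\<^sub>C x"
    using scaleC_add_left[of 1 1 x] by (simp add: scaleC_one)
  finally show "x = ?a + \<i> *\<^sub>C ?b"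
    by (simp add: scaleC_scaleC scaleC_one)
qed

lemma star_ii: "star b = b \<Longrightarrow> star (\<i> *\<^sub>C b) = - (\<i> *\<^sub>C (b :: 'a :: cstar_algebra))"
  using scaleC_scaleC[of "-1" "\<i>" b] by (simp add: star_scaleC scaleC_minus_one)

lemma ii_mult_ii: "(\<i> *\<^sub>C x) * (\<i> *\<^sub>C y) = - (x * (y :: 'a :: cstar_algebra))"
  by (simp add: mult_scaleC_left mult_scaleC_right scaleC_scaleC scaleC_minus_one)

text \<open>The cross terms occur with opposite signs: they cancel in the sum of the two products,
  and within each product when \<open>a\<close> and \<open>b\<close> commute.\<close>

lemma star_mult_self_decomposition:
  fixes a b :: "'a :: cstar_algebra"
  assumes "star a = a" "star b = b"
  shows "star (a + \<i> *\<^sub>C b) * (a + \<i> *\<^sub>C b) = a * a + b * b + \<i> *\<^sub>C (a * b) - \<i> *\<^sub>C (b * a)"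
    and "(a + \<i> *\<^sub>C b) * star (a + \<i> *\<^sub>C b) = a * a + b * b - \<i> *\<^sub>C (a * b) + \<i> *\<^sub>C (b * a)"
  using assms
  by (simp_all add: star_add star_ii distrib_left distrib_right left_diff_distrib right_diff_distrib
      ii_mult_ii) (simp_all add: mult_scaleC_left mult_scaleC_right)

section \<open>Nonnegative elements of a unital algebra\<close>

class unital_cstar_algebra = cstar_algebra + real_normed_algebra_1

lemma star_one [simp]: "star (1 :: 'a :: unital_cstar_algebra) = 1"
  using star_mult[of "star 1" "1 :: 'a"] by (simp add: star_star)

lemma star_power: "star (x ^ n) = star (x :: 'a :: unital_cstar_algebra) ^ n"
  by (induction n) (simp_all add: star_mult power_commutes)

text \<open>The C*-identity for selfadjoint elements, iterated by squaring; hence the exponents are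
  powers of two.\<close>

lemma norm_selfadjoint_power:
  fixes x :: "'a :: unital_cstar_algebra"
  assumes "star x = x"
  shows "norm (x ^ (2 ^ n)) = norm x ^ (2 ^ n)"
proof (induction n)
  case (Suc n)
  have "norm (x ^ (2 ^ n) * x ^ (2 ^ n)) = (norm (x ^ (2 ^ n)))\<^sup>2"
    by (rule norm_selfadjoint_square) (simp add: star_power assms)
  with Suc show ?case
    by (simp add: power_mult[symmetric] mult.commute[of 2] flip: power2_eq_square)
qed simp

section \<open>The cone of nonnegative elements\<close>

text \<open>In spectral terms the bound places the spectrum of the selfadjoint \<open>a\<close> in
  \<open>[0, 2 t]\<close>. Stated through the norm, closure under sums is just the triangle
  inequality.\<close>

definition nonneg :: "'a :: unital_cstar_algebra \<Rightarrow> bool" where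
  "nonneg a \<longleftrightarrow> star a = a \<and> (\<exists>t. norm (t *\<^sub>R 1 - a) \<le> t)"

lemma nonneg_selfadjoint: "nonneg a \<Longrightarrow> star a = a"
  by (simp add: nonneg_def)

text \<open>Lets a witness be enlarged, in particular made positive before dividing by it.\<close>

lemma norm_scaleR_one_diff_mono:
  fixes a :: "'a :: unital_cstar_algebra"
  assumes "norm (s *\<^sub>R 1 - a) \<le> s" "s \<le> t"
  shows "norm (t *\<^sub>R 1 - a) \<le> t"
proof -
  have "norm (t *\<^sub>R 1 - a) = norm ((t - s) *\<^sub>R 1 + (s *\<^sub>R 1 - a))"
    by (simp add: scaleR_left_diff_distrib)
  also have "\<dots> \<le> norm ((t - s) *\<^sub>R (1 :: 'a)) + norm (s *\<^sub>R 1 - a)"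
    by (rule norm_triangle_ineq)
  also have "\<dots> \<le> (t - s) + s"
    using assms by (intro add_mono) auto
  finally show ?thesis by simp
qed

lemma nonneg_add: "nonneg a \<Longrightarrow> nonneg b \<Longrightarrow> nonneg (a + b)"
proof -
  assume "nonneg a" "nonneg b"
  then obtain s t where *: "star a = a" "star b = b"
    "norm (s *\<^sub>R 1 - a) \<le> s" "norm (t *\<^sub>R 1 - b) \<le> t"
    by (auto simp: nonneg_def)
  have "norm ((s + t) *\<^sub>R 1 - (a + b)) \<le> s + t"
    using norm_triangle_ineq[of "s *\<^sub>R 1 - a" "t *\<^sub>R 1 - b"] *
    by (simp add: scaleR_left_distrib algebra_simps)
  then show ?thesis
    using * by (auto simp: nonneg_def star_add)
qed

lemma nonneg_scaleR: "nonneg a \<Longrightarrow> 0 \<le> c \<Longrightarrow> nonneg (c *\<^sub>R a)"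
proof -
  assume "nonneg a" "0 \<le> c"
  then obtain t where *: "star a = a" "norm (t *\<^sub>R 1 - a) \<le> t"
    by (auto simp: nonneg_def)
  have "norm ((c * t) *\<^sub>R 1 - c *\<^sub>R a) = c * norm (t *\<^sub>R 1 - a)"
    using \<open>0 \<le> c\<close> by (metis abs_of_nonneg norm_scaleR scaleR_right_diff_distrib scaleR_scaleR)
  also have "\<dots> \<le> c * t"
    using * \<open>0 \<le> c\<close> by (simp add: mult_left_mono)
  finally show ?thesis
    using * by (auto simp: nonneg_def star_scaleR)
qed

text \<open>
  The iterates \<open>y' = (k + y\<^sup>2) / 2\<close> converge to a solution of \<open>(1 - y)\<^sup>2 = 1 - k\<close>: their increments
  are dominated by those of the bounded real sequence obtained for \<open>k = 1\<close>, even when \<open>norm k = 1\<close>.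
\<close>

lemma sqrt_one_minus:
  fixes k :: "'a :: unital_cstar_algebra"
  assumes sa: "star k = k" and k1: "norm k \<le> 1"
  obtains r where "star r = r" "r * r = 1 - k" "norm (1 - r) \<le> 1"
    "\<And>z. z * k = k * z \<Longrightarrow> z * r = r * z"
proof -
  define y :: "nat \<Rightarrow> 'a" where "y = rec_nat 0 (\<lambda>_ y. (1/2) *\<^sub>R (k + y * y))"
  define e :: "nat \<Rightarrow> real" where "e = rec_nat 0 (\<lambda>_ e. (1/2) * (1 + e * e))"
  have y0: "y 0 = 0" and yS: "y (Suc n) = (1/2) *\<^sub>R (k + y n * y n)" for n
    by (simp_all add: y_def)
  have e0: "e 0 = 0" and eS: "e (Suc n) = (1/2) * (1 + e n * e n)" for n
    by (simp_all add: e_def)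
  have e01: "0 \<le> e n \<and> e n \<le> 1" for n
  proof (induction n)
    case (Suc n)
    then have "e n * e n \<le> 1 * 1" by (intro mult_mono) auto
    then show ?case by (simp add: eS)
  qed (simp add: e0)
  \<comment> \<open>Each iterate is a polynomial in \<open>k\<close>, so it commutes with whatever
    commutes with \<open>k\<close>; the limit inherits this.\<close>
  have comm: "z * k = k * z \<Longrightarrow> z * y n = y n * z" for z n
  proof (induction n)
    case (Suc n)
    then have *: "z * y n = y n * z" by simp
    have "z * (y n * y n) = (y n * y n) * z"
      by (metis * mult.assoc)
    with Suc.prems show ?case
      by (simp add: yS distrib_left distrib_right)
  qed (simp add: y0)
  have ycomm: "y m * y n = y n * y m" for m n
    by (intro comm comm[symmetric]) simp
  have ysa: "star (y n) = y n" for n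
    by (induction n) (simp_all add: y0 yS star_scaleR star_add star_mult sa)
  have yn: "norm (y n) \<le> e n" for n
  proof (induction n)
    case (Suc n)
    have "norm (k + y n * y n) \<le> norm k + norm (y n) * norm (y n)"
      by (meson add_left_mono norm_mult_ineq norm_triangle_le)
    also have "\<dots> \<le> 1 + e n * e n"
      using Suc k1 e01[of n] by (intro add_mono mult_mono) auto
    finally show ?case by (simp add: yS eS)
  qed (simp add: y0 e0)
  have inc: "norm (y (Suc n) - y n) \<le> e (Suc n) - e n" for n
  proof (induction n)
    case 0
    then show ?case using k1 by (simp add: y0 e0 yS eS)
  next
    case (Suc n)
    let ?a = "y (Suc n)" and ?b = "y n"
    have "y (Suc (Suc n)) - y (Suc n) = (1/2) *\<^sub>R (?a * ?a - ?b * ?b)"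
      by (subst (1 2) yS) (simp add: algebra_simps)
    \<comment> \<open>Commuting iterates allow a difference of squares to be factored; the same
      factorization for \<open>e\<close> closes the induction.\<close>
    also have "?a * ?a - ?b * ?b = (?a - ?b) * (?a + ?b)"
      using ycomm[of n "Suc n"] by (simp add: algebra_simps)
    finally have "norm (y (Suc (Suc n)) - y (Suc n)) = (1/2) * norm ((?a - ?b) * (?a + ?b))"
      by simp
    also have "\<dots> \<le> (1/2) * (norm (?a - ?b) * norm (?a + ?b))"
      by (simp add: norm_mult_ineq)
    also have "\<dots> \<le> (1/2) * ((e (Suc n) - e n) * (e (Suc n) + e n))"
    proof -
      have "norm (?a + ?b) \<le> e (Suc n) + e n"
        by (intro norm_triangle_le add_mono yn)
      then show ?thesis
        using Suc order_trans[OF norm_ge_zero Suc] by (intro mult_left_mono mult_mono) auto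
    qed
    also have "\<dots> = e (Suc (Suc n)) - e (Suc n)"
      by (subst (3 4) eS) (simp add: algebra_simps)
    finally show ?case .
  qed
  \<comment> \<open>The increments of \<open>e\<close> dominate norms, so \<open>e\<close>
    increases; being bounded by 1, it has a convergent telescoping series, which majorizes that of
    \<open>y\<close>.\<close>
  have "e n \<le> e (Suc n)" for n
    using order_trans[OF norm_ge_zero inc] by simp
  then have "incseq e" by (simp add: incseq_Suc_iff)
  then obtain L where "e \<longlonglongrightarrow> L"
    using incseq_convergent[of e 1] e01 by blast
  then have "summable (\<lambda>n. e (Suc n) - e n)"
    by (rule telescope_summable)
  then have "summable (\<lambda>n. y (Suc n) - y n)"
    by (rule summable_comparison_test'[where N = 0]) (use inc in auto)
  then have "convergent (\<lambda>n. \<Sum>i<n. y (Suc i) - y i)"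
    by (simp add: summable_iff_convergent)
  then have "convergent y"
    by (simp add: sum_lessThan_telescope y0)
  then obtain l where l: "y \<longlonglongrightarrow> l" by (auto simp: convergent_def)
  have "(\<lambda>n. (1/2) *\<^sub>R (k + y n * y n)) \<longlonglongrightarrow> (1/2) *\<^sub>R (k + l * l)"
    by (intro tendsto_intros l)
  moreover have "(\<lambda>n. (1/2) *\<^sub>R (k + y n * y n)) \<longlonglongrightarrow> l"
    using LIMSEQ_Suc[OF l] by (simp add: yS)
  ultimately have "l = (1/2) *\<^sub>R (k + l * l)"
    by (rule LIMSEQ_unique[THEN sym])
  then have ll: "l + l = k + l * l"
    by (metis scaleR_2 scaleR_scaleR scaleR_one nonzero_eq_divide_eq zero_neq_numeral
        mult.commute)
  show ?thesis
  proof (rule that[of "1 - l"])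
    have "star l = l"
      using closed_sequentially[OF closed_selfadjoint _ l] ysa by simp
    then show "star (1 - l) = 1 - l"
      by (simp add: star_diff)
    show "(1 - l) * (1 - l) = 1 - k"
      using ll by (simp add: algebra_simps)
    have "norm (y n) \<le> 1" for n
      using yn[of n] e01[of n] by linarith
    then show "norm (1 - (1 - l)) \<le> 1"
      using LIMSEQ_le_const2[OF tendsto_norm[OF l], of 1] by auto
    show "z * (1 - l) = (1 - l) * z" if "z * k = k * z" for z
    proof -
      have "(\<lambda>n. z * y n) \<longlonglongrightarrow> z * l" "(\<lambda>n. y n * z) \<longlonglongrightarrow> l * z"
        by (intro tendsto_intros l)+
      then have "z * l = l * z"
        using comm[OF that] by (simp add: LIMSEQ_unique)
      then show ?thesis by (simp add: algebra_simps)
    qed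
  qed
qed

lemma norm_unitary_le_1:
  fixes u :: "'a :: unital_cstar_algebra"
  shows "star u * u = 1 \<Longrightarrow> norm u \<le> 1"
  using cstar_identity[of u] by (auto simp: power2_eq_1_iff)

text \<open>
  The unitary \<open>u = s + i r\<close> with \<open>r\<^sup>2 = 1 - s\<^sup>2\<close> has \<open>i r = (u - u\<^sup>*) / 2\<close>, so \<open>norm r \<le> 1\<close>.
\<close>

lemma norm_one_minus_square_le_1:
  fixes s :: "'a :: unital_cstar_algebra"
  assumes "star s = s" "norm s \<le> 1"
  shows "norm (1 - s * s) \<le> 1"
proof -
  have "norm (s * s) \<le> 1"
    using assms by (simp add: norm_selfadjoint_square power_le_one)
  then obtain r where r: "star r = r" "r * r = 1 - s * s" "s * r = r * s"
    using sqrt_one_minus[of "s * s"] assms(1) by (metis mult.assoc star_mult)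
  define u where "u = s + \<i> *\<^sub>C r"
  have su: "star u = s - \<i> *\<^sub>C r"
    by (simp add: u_def star_add star_ii assms r)
  have "star u * u = 1"
    unfolding u_def by (subst star_mult_self_decomposition) (use assms r in auto)
  then have u: "norm u \<le> 1"
    by (rule norm_unitary_le_1)
  have "u - star u = 2 *\<^sub>R (\<i> *\<^sub>C r)"
    unfolding su by (simp add: u_def scaleR_2)
  then have "2 * norm r \<le> norm u + norm (star u)"
    using norm_triangle_ineq4[of u "star u"] by (simp add: norm_scaleC)
  with u have "norm r \<le> 1" by simp
  moreover have "norm (r * r) = (norm r)\<^sup>2"
    using r(1) by (simp add: norm_selfadjoint_square)
  ultimately show ?thesis
    using r by (simp add: power_le_one)
qed

lemma norm_scaleR_one_minus_square:
  fixes s :: "'a :: unital_cstar_algebra"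
  assumes "star s = s" "norm (s * s) \<le> t"
  shows "norm (t *\<^sub>R 1 - s * s) \<le> t"
proof (cases "t = 0")
  case False
  then have "0 < t"
    using order_trans[OF norm_ge_zero assms(2)] by simp
  let ?s = "(1 / sqrt t) *\<^sub>R s"
  have "(norm s)\<^sup>2 \<le> t"
    using assms by (simp add: norm_selfadjoint_square)
  then have "norm ?s \<le> 1"
    using \<open>0 < t\<close> by (simp add: real_le_rsqrt)
  then have "norm (1 - ?s * ?s) \<le> 1"
    by (intro norm_one_minus_square_le_1) (simp add: star_scaleR assms)
  moreover have "t *\<^sub>R 1 - s * s = t *\<^sub>R (1 - ?s * ?s)"
    using \<open>0 < t\<close> by (simp add: scaleR_right_diff_distrib)
  ultimately show ?thesis
    using \<open>0 < t\<close> by (simp add: mult_left_le)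
qed (use assms in auto)

section \<open>Squares, square roots and closedness of the cone\<close>

lemma nonneg_square:
  "star s = s \<Longrightarrow> nonneg (s * (s :: 'a :: unital_cstar_algebra))"
  using norm_scaleR_one_minus_square[of s "norm (s * s)"] by (auto simp: nonneg_def star_mult)

text \<open>With a positive witness \<open>t\<close>, write \<open>a = t (1 - k)\<close> where
  \<open>k = 1 - a / t\<close> has norm at most 1, and scale the root \<open>r\<close> of
  \<open>1 - k\<close> by \<open>sqrt t\<close>. Since \<open>norm (1 - r) \<le> 1\<close>, the root
  is itself nonnegative with witness 1.\<close>

lemma nonneg_sqrt:
  fixes a :: "'a :: unital_cstar_algebra"
  assumes "nonneg a"
  obtains r where "nonneg r" "r * r = a" "\<And>z. z * a = a * z \<Longrightarrow> z * r = r * z"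
proof -
  obtain s where "norm (s *\<^sub>R 1 - a) \<le> s"
    using assms by (auto simp: nonneg_def)
  moreover from this have "0 \<le> s"
    by (rule order_trans[OF norm_ge_zero])
  ultimately obtain t where t: "norm (t *\<^sub>R 1 - a) \<le> t" "0 < t"
    using norm_scaleR_one_diff_mono[of s a "s + 1"] by force
  let ?k = "1 - (1/t) *\<^sub>R a"
  have "star ?k = ?k"
    using assms by (simp add: star_diff star_scaleR nonneg_selfadjoint)
  moreover have "norm ?k \<le> 1"
  proof -
    have "?k = (1/t) *\<^sub>R (t *\<^sub>R 1 - a)"
      using t by (simp add: scaleR_right_diff_distrib)
    then show ?thesis
      using t by simp
  qed
  ultimately obtain r where r: "star r = r" "r * r = 1 - ?k" "norm (1 - r) \<le> 1"
    "\<And>z. z * ?k = ?k * z \<Longrightarrow> z * r = r * z"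
    using sqrt_one_minus by blast
  show ?thesis
  proof (rule that[of "sqrt t *\<^sub>R r"])
    have "nonneg r"
      using r(1,3) by (auto simp: nonneg_def intro: exI[of _ 1])
    then show "nonneg (sqrt t *\<^sub>R r)"
      using t by (intro nonneg_scaleR) auto
    show "sqrt t *\<^sub>R r * sqrt t *\<^sub>R r = a"
      using t r(2) by simp
    show "z * sqrt t *\<^sub>R r = sqrt t *\<^sub>R r * z" if "z * a = a * z" for z
      using r(4)[of z] that by (simp add: algebra_simps)
  qed
qed

text \<open>The bound for squares applies once \<open>a\<close> is written as one. The witness can
  thus be \<open>norm a\<close>, a continuous function of \<open>a\<close>, which makes the cone
  closed.\<close>

lemma nonneg_norm_le:
  fixes a :: "'a :: unital_cstar_algebra"
  assumes "nonneg a" "norm a \<le> t"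
  shows "norm (t *\<^sub>R 1 - a) \<le> t"
proof -
  obtain r where "nonneg r" "r * r = a"
    using nonneg_sqrt[OF assms(1)] by blast
  then show ?thesis
    using norm_scaleR_one_minus_square[of r t] assms(2) by (simp add: nonneg_selfadjoint)
qed

lemma closed_nonneg: "closed {a :: 'a :: unital_cstar_algebra. nonneg a}"
proof -
  have "{a :: 'a. nonneg a} = {a. star a = a} \<inter> {a. norm (norm a *\<^sub>R 1 - a) \<le> norm a}"
    using nonneg_norm_le by (auto simp: nonneg_def)
  also have "closed \<dots>"
    by (intro closed_Int closed_selfadjoint closed_Collect_le continuous_intros)
  finally show ?thesis .
qed

text \<open>Commuting roots \<open>s\<close> of \<open>a\<close> and \<open>r\<close> of
  \<open>- a\<close> give \<open>u = s + i r\<close> with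
  \<open>star u * u = s\<^sup>2 + r\<^sup>2 = 0\<close>; so \<open>u\<close> and its selfadjoint
  part \<open>s\<close> vanish.\<close>

lemma nonneg_antisym:
  fixes a :: "'a :: unital_cstar_algebra"
  assumes "nonneg a" "nonneg (- a)"
  shows "a = 0"
proof -
  obtain s where s: "nonneg s" "s * s = a"
    using nonneg_sqrt[OF assms(1)] by blast
  obtain r where r: "nonneg r" "r * r = - a" "\<And>z. z * (-a) = (-a) * z \<Longrightarrow> z * r = r * z"
    using nonneg_sqrt[OF assms(2)] by blast
  have sr: "s * r = r * s"
    by (rule r(3)) (simp add: s(2)[symmetric] mult.assoc)
  note sa = nonneg_selfadjoint[OF s(1)] nonneg_selfadjoint[OF r(1)]
  have "star (s + \<i> *\<^sub>C r) * (s + \<i> *\<^sub>C r) = 0"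
    by (subst star_mult_self_decomposition) (simp_all add: sa s r(2) sr)
  then have "s + \<i> *\<^sub>C r = 0" by simp
  moreover have "s - \<i> *\<^sub>C r = star (s + \<i> *\<^sub>C r)"
    by (simp add: star_add star_ii sa)
  ultimately have "s + s = 0"
    by (metis add_cancel_right_left add_diff_cancel_right' diff_add_cancel star_zero)
  then have "s = 0"
    by (simp flip: scaleR_2)
  then show ?thesis using s by simp
qed

text \<open>
  With \<open>T = t - a\<close> the hypothesis bounds \<open>T\<^sup>n\<close> by \<open>(1 + n C) t\<^sup>n\<close>. Since \<open>T\<close> is selfadjoint, its
  norm is \<open>norm (T\<^sup>n)\<close> to the power \<open>1 / n\<close> for \<open>n = 2\<^sup>k\<close>, and the linear factor disappears in the limit.
\<close>

lemma nonneg_criterion: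
  fixes a :: "'a :: unital_cstar_algebra"
  assumes sa: "star a = a" and t: "0 < t"
    and bound: "\<And>j. norm (a * (t *\<^sub>R 1 - a) ^ j) \<le> C * t ^ Suc j"
  shows "nonneg a"
proof -
  let ?T = "t *\<^sub>R 1 - a"
  have T_bound: "norm (?T ^ n) \<le> (1 + real n * C) * t ^ n" for n
  proof (induction n)
    case (Suc n)
    have "?T ^ Suc n = t *\<^sub>R ?T ^ n - a * ?T ^ n"
      by (simp add: left_diff_distrib)
    then have "norm (?T ^ Suc n) \<le> t * norm (?T ^ n) + C * t ^ Suc n"
      using bound[of n] t norm_triangle_ineq4[of "t *\<^sub>R ?T ^ n" "a * ?T ^ n"] by simp
    also have "\<dots> \<le> t * ((1 + real n * C) * t ^ n) + C * t ^ Suc n"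
      using Suc t by (intro add_right_mono mult_left_mono) auto
    finally show ?case by (simp add: algebra_simps)
  qed simp
  have "norm ?T \<le> t"
  proof (rule ccontr)
    assume "\<not> norm ?T \<le> t"
    define \<rho> where "\<rho> = norm ?T / t"
    have \<rho>: "1 < \<rho>"
      using \<open>\<not> norm ?T \<le> t\<close> t by (simp add: \<rho>_def)
    have "(\<lambda>n. inverse \<rho> ^ n + C * (real n * inverse \<rho> ^ n)) \<longlonglongrightarrow> 0 + C * 0"
      using \<rho> powser_times_n_limit_0[of "inverse \<rho>"]
      by (intro tendsto_intros LIMSEQ_power_zero) (simp_all add: inverse_less_1_iff)
    then have "\<forall>\<^sub>F n in sequentially. inverse \<rho> ^ n + C * (real n * inverse \<rho> ^ n) < 1"
      by (rule order_tendstoD) simp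
    then obtain N where N: "\<And>n. n \<ge> N \<Longrightarrow> inverse \<rho> ^ n + C * (real n * inverse \<rho> ^ n) < 1"
      by (auto simp: eventually_sequentially)
    \<comment> \<open>This exponent is a power of two, so the norm of the power is the power of the
      norm, and it is at least \<open>N\<close>.\<close>
    define m :: nat where "m = 2 ^ N"
    have "norm ?T ^ m = norm (?T ^ m)"
      unfolding m_def using sa by (subst norm_selfadjoint_power) (simp_all add: star_diff star_scaleR)
    also have "\<dots> \<le> (1 + real m * C) * t ^ m"
      by (rule T_bound)
    finally have "\<rho> ^ m \<le> 1 + real m * C"
      using t by (simp add: \<rho>_def power_divide divide_le_eq)
    then have "1 \<le> inverse \<rho> ^ m * (1 + real m * C)"
      using \<rho> by (simp add: power_inverse field_simps)
    moreover have "inverse \<rho> ^ m + C * (real m * inverse \<rho> ^ m) < 1"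
      by (rule N) (simp add: m_def less_imp_le)
    ultimately show False
      by (simp add: algebra_simps)
  qed
  then show ?thesis
    using sa by (auto simp: nonneg_def)
qed

text \<open>Here \<open>r\<close> is an absolute value of \<open>h\<close>. For
  \<open>k = r + h\<close> one has \<open>k * k = 2 r k\<close>, so
  \<open>k (t - k)\<^sup>j = k (t - 2 r)\<^sup>j\<close>, and \<open>norm (t - 2 r) \<le> t\<close>
  for large \<open>t\<close> because \<open>2 r\<close> is nonnegative.\<close>

lemma nonneg_abs_add:
  fixes h r :: "'a :: unital_cstar_algebra"
  assumes h: "star h = h" and r: "nonneg r" "r * r = h * h" "h * r = r * h"
  shows "nonneg (r + h)"
proof (rule nonneg_criterion)
  let ?k = "r + h"
  define t where "t = (norm r + 1) * 2"
  have t: "norm (2 *\<^sub>R r) \<le> t" "0 < t"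
    by (auto simp: t_def intro: add_nonneg_pos)
  let ?T = "t *\<^sub>R 1 - 2 *\<^sub>R r"
  have T: "norm ?T \<le> t"
    using r t by (intro nonneg_norm_le nonneg_scaleR) auto
  show "star ?k = ?k"
    using h r by (simp add: star_add nonneg_selfadjoint)
  show "0 < t" by fact
  have kT: "?k * ?T = ?T * ?k"
    using r by (simp add: algebra_simps)
  have kS: "?k * (t *\<^sub>R 1 - ?k) = ?k * ?T"
    using r by (simp add: scaleR_2 algebra_simps)
  have "?k * (t *\<^sub>R 1 - ?k) ^ j = ?k * ?T ^ j" for j
  proof (induction j)
    case (Suc j)
    have "?k * (t *\<^sub>R 1 - ?k) ^ Suc j = (?k * ?T) * (t *\<^sub>R 1 - ?k) ^ j"
      by (simp only: power_Suc mult.assoc[symmetric] kS)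
    also have "\<dots> = ?T * (?k * ?T ^ j)"
      by (simp only: kT mult.assoc Suc)
    also have "\<dots> = ?k * ?T ^ Suc j"
      by (simp only: power_Suc mult.assoc[symmetric] kT)
    finally show ?case .
  qed simp
  then show "norm (?k * (t *\<^sub>R 1 - ?k) ^ j) \<le> (norm ?k / t) * t ^ Suc j" for j
    using t order_trans[OF norm_power_ineq power_mono[OF T norm_ge_zero], of j]
    by (auto intro!: order_trans[OF norm_mult_ineq] mult_left_mono)
qed

section \<open>Jordan decomposition and Kaplansky's argument\<close>

text \<open>The parts are \<open>(r + h) / 2\<close> and \<open>(r - h) / 2\<close> with
  \<open>r\<close> the root of \<open>h * h\<close>; they are orthogonal because \<open>r\<close>
  commutes with \<open>h\<close> and has the same square.\<close>

lemma jordan_decomposition: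
  fixes h :: "'a :: unital_cstar_algebra"
  assumes h: "star h = h"
  obtains p m where "nonneg p" "nonneg m" "h = p - m" "p * m = 0" "m * p = 0"
proof -
  obtain r where r: "nonneg r" "r * r = h * h" "h * r = r * h"
    using nonneg_sqrt[OF nonneg_square[OF h]] mult.assoc[of h h h] by metis
  have "nonneg (r + h)" "nonneg (r + - h)"
    using r h by (auto intro!: nonneg_abs_add simp: star_minus simp del: add_uminus_conv_diff)
  then have "nonneg ((1/2) *\<^sub>R (r + h))" "nonneg ((1/2) *\<^sub>R (r - h))"
    by (auto intro: nonneg_scaleR)
  moreover have "h = (1/2) *\<^sub>R (r + h) - (1/2) *\<^sub>R (r - h)"
    by (simp flip: scaleR_right_diff_distrib scaleR_2)
  moreover have "(r + h) * (r - h) = 0" "(r - h) * (r + h) = 0"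
    using r by (simp_all add: algebra_simps)
  ultimately show ?thesis
    by (intro that[of "(1/2) *\<^sub>R (r + h)" "(1/2) *\<^sub>R (r - h)"])
      (simp_all only: mult_scaleR_left mult_scaleR_right scaleR_zero_right)
qed

text \<open>The relation \<open>x (t - star x * x)\<^sup>j = (t - x * star x)\<^sup>j x\<close>
  turns the norm bound for \<open>x * star x\<close> into the power bounds needed for
  \<open>star x * x\<close>.\<close>

lemma nonneg_star_mult_self_swap:
  fixes x :: "'a :: unital_cstar_algebra"
  assumes "nonneg (x * star x)"
  shows "nonneg (star x * x)"
proof (rule nonneg_criterion)
  let ?a = "star x * x" and ?b = "x * star x"
  define t where "t = norm ?b + 1"
  have t: "0 < t" "norm ?b \<le> t"
    by (auto simp: t_def intro: add_nonneg_pos)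
  show "star ?a = ?a" by (simp add: star_mult star_star)
  show "0 < t" by fact
  have T: "norm (t *\<^sub>R 1 - ?b) \<le> t"
    using assms t by (intro nonneg_norm_le) auto
  have "x * (t *\<^sub>R 1 - ?a) ^ j = (t *\<^sub>R 1 - ?b) ^ j * x" for j
  proof (induction j)
    case (Suc j)
    have "x * (t *\<^sub>R 1 - ?a) = (t *\<^sub>R 1 - ?b) * x"
      by (simp add: algebra_simps)
    then show ?case
      by (simp only: power_Suc mult.assoc[symmetric]) (simp only: mult.assoc Suc)
  qed simp
  then have "?a * (t *\<^sub>R 1 - ?a) ^ j = star x * ((t *\<^sub>R 1 - ?b) ^ j * x)" for j
    by (simp add: mult.assoc)
  moreover have "norm (star x * ((t *\<^sub>R 1 - ?b) ^ j * x)) \<le> norm x * (t ^ j * norm x)" for j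
    using norm_power_ineq[of "t *\<^sub>R 1 - ?b" j] power_mono[OF T norm_ge_zero, of j]
    using t by (intro order_trans[OF norm_mult_ineq] mult_mono) auto
  ultimately show "norm (?a * (t *\<^sub>R 1 - ?a) ^ j) \<le> ((norm x)\<^sup>2 / t) * t ^ Suc j" for j
    using t by (simp add: power2_eq_square mult_ac)
qed

text \<open>For \<open>x = a + i b\<close> the sum \<open>star x * x + x * star x\<close> is
  \<open>2 (a\<^sup>2 + b\<^sup>2)\<close>, so the hypothesis makes \<open>x * star x\<close>
  nonnegative. Swapping the factors puts both \<open>star x * x\<close> and its negative in the
  cone.\<close>

lemma nonneg_uminus_star_mult_self:
  fixes x :: "'a :: unital_cstar_algebra"
  assumes "nonneg (- (star x * x))"
  shows "x = 0"
proof -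
  obtain a b where ab: "star a = a" "star b = b" "x = a + \<i> *\<^sub>C b"
    using selfadjoint_decomposition[of x] by blast
  have "star x * x + x * star x = 2 *\<^sub>R (a * a + b * b)"
    unfolding ab(3) star_mult_self_decomposition[OF ab(1,2)] by (simp add: scaleR_2)
  then have "x * star x = 2 *\<^sub>R (a * a + b * b) + - (star x * x)"
    by (simp add: algebra_simps)
  also have "nonneg \<dots>"
    using ab assms by (intro nonneg_add nonneg_scaleR nonneg_square) auto
  finally have "nonneg (star x * x)"
    by (rule nonneg_star_mult_self_swap)
  then have "star x * x = 0"
    using assms by (rule nonneg_antisym)
  then show ?thesis by simp
qed

theorem nonneg_star_mult_self: "nonneg (star x * (x :: 'a :: unital_cstar_algebra))"
proof -
  obtain p m where pm: "nonneg p" "nonneg m" "star x * x = p - m" "p * m = 0"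
    by (rule jordan_decomposition[of "star x * x"]) (simp_all add: star_mult star_star)
  have sa: "star m = m"
    using pm(2) by (rule nonneg_selfadjoint)
  obtain w where w: "nonneg w" "w * w = m"
    using nonneg_sqrt[OF pm(2)] by blast
  \<comment> \<open>Compressing by the negative part \<open>m\<close> leaves only
    \<open>- m\<^sup>3\<close>, since \<open>p * m = 0\<close>.\<close>
  have "star (x * m) * (x * m) = m * (star x * x) * m"
    by (simp add: star_mult sa mult.assoc)
  also have "\<dots> = - (m * m * m)"
    using pm(4) by (simp add: pm(3) algebra_simps)
  finally have "- (star (x * m) * (x * m)) = m * m * m"
    by simp
  \<comment> \<open>The factor \<open>w * m\<close> is selfadjoint because \<open>w\<close> commutes
    with \<open>m = w * w\<close>.\<close>
  also have "\<dots> = (w * m) * (w * m)"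
    unfolding w(2)[symmetric] by (simp add: mult.assoc)
  also have "nonneg \<dots>"
    using w by (intro nonneg_square) (metis mult.assoc nonneg_selfadjoint star_mult)
  finally have "x * m = 0"
    by (rule nonneg_uminus_star_mult_self)
  \<comment> \<open>Multiply \<open>x * m = 0\<close> on the left by \<open>star x\<close>.\<close>
  then have "(p - m) * m = 0"
    by (simp flip: pm(3) add: mult.assoc)
  then have "star m * m = 0"
    using pm(4) by (simp add: algebra_simps sa)
  then show ?thesis
    using pm by simp
qed

section \<open>The unitization\<close>

lemma bounded_linear_scaleC: "bounded_linear (\<lambda>y :: 'a :: cstar_algebra. c *\<^sub>C y)"
proof (rule bounded_linear_intro[where K = "cmod c"])
  show "c *\<^sub>C r *\<^sub>R x = r *\<^sub>R c *\<^sub>C x" for r and x :: 'a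
    by (simp flip: scaleC_of_real add: scaleC_scaleC mult.commute)
qed (simp_all add: scaleC_add_right norm_scaleC)

text \<open>A pair \<open>(a, c)\<close> stands for \<open>a + c 1\<close>. As a codatatype it lets
  \<open>primcorec\<close> define the operations by their two projections.\<close>

codatatype 'a unitization = Unitization (alg_part: 'a) (scal_part: complex)

lemma unitization_eq_iff: "x = y \<longleftrightarrow> alg_part x = alg_part y \<and> scal_part x = scal_part y"
  by (auto intro: unitization.expand)

instantiation unitization :: (cstar_algebra) complex_vector
begin

primcorec zero_unitization where
  "alg_part 0 = 0"
| "scal_part 0 = 0"

primcorec plus_unitization where
  "alg_part (x + y) = alg_part x + alg_part y"
| "scal_part (x + y) = scal_part x + scal_part y"

primcorec uminus_unitization where
  "alg_part (- x) = - alg_part x"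
| "scal_part (- x) = - scal_part x"

primcorec minus_unitization where
  "alg_part (x - y) = alg_part x - alg_part y"
| "scal_part (x - y) = scal_part x - scal_part y"

primcorec scaleR_unitization where
  "alg_part (r *\<^sub>R x) = r *\<^sub>R alg_part x"
| "scal_part (r *\<^sub>R x) = complex_of_real r * scal_part x"

primcorec scaleC_unitization where
  "alg_part (c *\<^sub>C x) = c *\<^sub>C alg_part x"
| "scal_part (c *\<^sub>C x) = c * scal_part x"

instance
  by standard
    (simp_all add: unitization_eq_iff algebra_simps scaleC_add_right scaleC_add_left scaleC_scaleC
      scaleC_one scaleC_of_real)

end

instantiation unitization :: (cstar_algebra) real_algebra_1
begin

primcorec one_unitization where
  "alg_part 1 = 0"
| "scal_part 1 = 1"

primcorec times_unitization where
  "alg_part (x * y) = alg_part x * alg_part y + scal_part x *\<^sub>C alg_part y + scal_part y *\<^sub>C alg_part x"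
| "scal_part (x * y) = scal_part x * scal_part y"

instance
proof
  fix x y z :: "'a unitization" and r :: real
  show "x * y * z = x * (y * z)"
    by (simp add: unitization_eq_iff algebra_simps scaleC_add_right scaleC_add_left scaleC_scaleC
        mult_scaleC_left mult_scaleC_right)
  show "(x + y) * z = x * z + y * z" "x * (y + z) = x * y + x * z"
    by (simp_all add: unitization_eq_iff algebra_simps scaleC_add_right scaleC_add_left)
  show "1 * x = x" "x * 1 = x"
    by (simp_all add: unitization_eq_iff scaleC_one)
  show "(0 :: 'a unitization) \<noteq> 1"
    by (simp add: unitization_eq_iff)
  show "r *\<^sub>R x * y = r *\<^sub>R (x * y)" "x * r *\<^sub>R y = r *\<^sub>R (x * y)"
    by (simp_all add: unitization_eq_iff algebra_simps scaleC_scaleC flip: scaleC_of_real)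
      (simp_all add: scaleC_add_right scaleC_scaleC mult_scaleC_left mult_scaleC_right mult.commute)
qed

end

section \<open>Norm, completeness and C*-identity of the unitization\<close>

text \<open>The algebra is an ideal of its unitization, which therefore acts on it by left
  multiplication; the operator norm of this action enters the norm below.\<close>

definition left_action :: "'a :: cstar_algebra unitization \<Rightarrow> 'a \<Rightarrow> 'a" where
  "left_action x y = alg_part x * y + scal_part x *\<^sub>C y"

lemma bounded_linear_left_action: "bounded_linear (left_action x)"
  unfolding left_action_def[abs_def]
  by (intro bounded_linear_add bounded_linear_mult_right bounded_linear_scaleC)

lemma left_action_add: "left_action (x + y) = (\<lambda>z. left_action x z + left_action y z)"
  by (simp add: left_action_def fun_eq_iff algebra_simps scaleC_add_left)

lemma left_action_mult: "left_action (x * y) = left_action x \<circ> left_action y"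
  by (simp add: left_action_def fun_eq_iff algebra_simps scaleC_add_right scaleC_scaleC
      mult_scaleC_left mult_scaleC_right)

lemma left_action_scaleC: "left_action (c *\<^sub>C x) = (\<lambda>z. c *\<^sub>C left_action x z)"
  by (simp add: left_action_def fun_eq_iff algebra_simps scaleC_add_right scaleC_scaleC
      mult_scaleC_left)

text \<open>By the C*-identity the operator norm is already reached at \<open>star x\<close>; hence
  the algebra embeds isometrically.\<close>

lemma onorm_mult_left: "onorm (\<lambda>z. x * z) = norm (x :: 'a :: cstar_algebra)"
proof (rule antisym)
  show "onorm (\<lambda>z. x * z) \<le> norm x"
    by (rule onorm_bound) (simp_all add: norm_mult_ineq)
  have "norm (x * star x) \<le> onorm (\<lambda>z. x * z) * norm (star x)"
    by (rule onorm[OF bounded_linear_mult_right])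
  moreover have "norm (x * star x) = norm x * norm x"
    using cstar_identity[of "star x"] by (simp add: star_star power2_eq_square)
  ultimately have "norm x * norm x \<le> onorm (\<lambda>z. x * z) * norm x"
    by simp
  then show "norm x \<le> onorm (\<lambda>z. x * z)"
    by (cases "x = 0") (simp_all add: onorm_pos_le bounded_linear_mult_right)
qed

text \<open>
  If the algebra already has a unit, the operator norm of \<open>left_action\<close> is only a seminorm on the
  unitization. The maximum with the norm of the scalar part is a norm in all cases.
\<close>

instantiation unitization :: (cstar_algebra) real_normed_algebra_1
begin

definition norm_unitization where
  "norm x = max (cmod (scal_part x)) (onorm (left_action x))"

definition dist_unitization where
  "dist x y = norm (x - y)" for x y :: "'a unitization"

definition sgn_unitization where
  "sgn x = inverse (norm x) *\<^sub>R x" for x :: "'a unitization"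

definition uniformity_unitization where
  "uniformity = (INF e\<in>{0 <..}. principal {(x, y :: 'a unitization). dist x y < e})"

definition open_unitization where
  "open U \<longleftrightarrow> (\<forall>x\<in>U. eventually (\<lambda>(x', y). x' = x \<longrightarrow> y \<in> U) uniformity)"
  for U :: "'a unitization set"

instance
proof
  fix x y :: "'a unitization" and r :: real
  show "norm x = 0 \<longleftrightarrow> x = 0"
  proof
    assume "norm x = 0"
    then have "scal_part x = 0" "onorm (left_action x) = 0"
      using onorm_pos_le[OF bounded_linear_left_action, of x]
      by (auto simp: norm_unitization_def max_def split: if_splits)
    moreover from this have "norm (alg_part x) = 0"
      by (simp add: left_action_def[abs_def] onorm_mult_left)
    ultimately show "x = 0"
      by (simp add: unitization_eq_iff)
  qed (simp add: norm_unitization_def left_action_def[abs_def] onorm_zero)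
  show "norm (x + y) \<le> norm x + norm y"
    using norm_triangle_ineq[of "scal_part x" "scal_part y"]
      onorm_triangle[OF bounded_linear_left_action[of x] bounded_linear_left_action[of y]]
    by (simp add: norm_unitization_def left_action_add) linarith
  have "left_action (r *\<^sub>R x) = (\<lambda>z. r *\<^sub>R left_action x z)"
    by (simp add: fun_eq_iff left_action_def algebra_simps flip: scaleC_of_real)
      (simp add: mult_scaleC_left scaleC_add_right scaleC_scaleC)
  then show "norm (r *\<^sub>R x) = \<bar>r\<bar> * norm x"
    by (simp add: norm_unitization_def onorm_scaleR bounded_linear_left_action norm_mult
        max_mult_distrib_left)
  have "onorm (left_action (x * y)) \<le> onorm (left_action x) * onorm (left_action y)"
    unfolding left_action_mult by (intro onorm_compose bounded_linear_left_action)
  also have "\<dots> \<le> norm x * norm y"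
    by (intro mult_mono) (auto simp: norm_unitization_def onorm_pos_le bounded_linear_left_action le_max_iff_disj)
  finally have "onorm (left_action (x * y)) \<le> norm x * norm y" .
  moreover have "cmod (scal_part (x * y)) \<le> norm x * norm y"
    unfolding times_unitization.sel norm_mult
    by (intro mult_mono) (auto simp: norm_unitization_def le_max_iff_disj)
  ultimately show "norm (x * y) \<le> norm x * norm y"
    by (subst norm_unitization_def) simp
  have "left_action (1 :: 'a unitization) = (\<lambda>z. z)"
    by (simp add: left_action_def fun_eq_iff scaleC_one)
  then show "norm (1 :: 'a unitization) = 1"
    by (simp add: norm_unitization_def max_def antisym onorm_id_le)
qed (simp_all add: dist_unitization_def sgn_unitization_def uniformity_unitization_def
    open_unitization_def)

end

definition to_unitization :: "'a :: cstar_algebra \<Rightarrow> 'a unitization" where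
  "to_unitization a = Unitization a 0"

lemma to_unitization_sel [simp]: "alg_part (to_unitization a) = a" "scal_part (to_unitization a) = 0"
  by (simp_all add: to_unitization_def)

lemma norm_to_unitization [simp]: "norm (to_unitization a) = norm a"
  by (simp add: norm_unitization_def left_action_def[abs_def] onorm_mult_left)

lemma to_unitization_simps:
  "to_unitization (a + b) = to_unitization a + to_unitization b" "to_unitization (a - b) = to_unitization a - to_unitization b"
  "to_unitization (- a) = - to_unitization a" "to_unitization (a * b) = to_unitization a * to_unitization b" "to_unitization (r *\<^sub>R a) = r *\<^sub>R to_unitization a"
  "to_unitization a = 0 \<longleftrightarrow> a = 0"
  by (simp_all add: unitization_eq_iff)

lemma unitization_decomposition: "x = to_unitization (alg_part x) + scal_part x *\<^sub>C 1"
  by (simp add: unitization_eq_iff)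

text \<open>One inequality suffices for the operator norm: for \<open>c \<noteq> 0\<close>, applying
  it to \<open>inverse c\<close> and \<open>c *\<^sub>C x\<close> yields the converse.\<close>

lemma norm_scaleC_unitization: "norm (c *\<^sub>C x) = cmod c * norm (x :: 'a :: cstar_algebra unitization)"
proof -
  have le: "onorm (left_action (c *\<^sub>C x)) \<le> cmod c * onorm (left_action x)" for c and x :: "'a unitization"
  proof (rule onorm_bound)
    show "0 \<le> cmod c * onorm (left_action x)"
      by (simp add: onorm_pos_le bounded_linear_left_action)
    show "norm (left_action (c *\<^sub>C x) z) \<le> cmod c * onorm (left_action x) * norm z" for z
      using onorm[OF bounded_linear_left_action, of x z]
      by (simp add: left_action_scaleC norm_scaleC mult_left_mono mult.assoc)
  qed
  have "onorm (left_action (c *\<^sub>C x)) = cmod c * onorm (left_action x)"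
  proof (cases "c = 0")
    case True
    then show ?thesis
      using le[of c x] onorm_pos_le[OF bounded_linear_left_action, of "c *\<^sub>C x"] by simp
  next
    case False
    then have "onorm (left_action x) \<le> inverse (cmod c) * onorm (left_action (c *\<^sub>C x))"
      using le[of "inverse c" "c *\<^sub>C x"] by (simp add: scaleC_scaleC norm_inverse)
    then have "cmod c * onorm (left_action x) \<le> onorm (left_action (c *\<^sub>C x))"
      using False by (simp add: field_simps)
    then show ?thesis
      using le[of c x] by simp
  qed
  then show ?thesis
    by (simp add: norm_unitization_def norm_mult max_mult_distrib_left)
qed

text \<open>The scalar part is bounded by the norm and the algebra part by twice the norm, so both
  components of a Cauchy sequence converge and their limits reassemble.\<close>

instance unitization :: (cstar_algebra) banach
proof
  fix X :: "nat \<Rightarrow> 'a unitization"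
  assume X: "Cauchy X"
  have le: "cmod (scal_part x) \<le> norm x" for x :: "'a unitization"
    by (simp add: norm_unitization_def)
  then have "dist (scal_part x) (scal_part y) \<le> dist x y" for x y :: "'a unitization"
    by (simp add: dist_norm flip: minus_unitization.sel)
  then have "Cauchy (\<lambda>n. scal_part (X n))"
    using X unfolding Cauchy_def by (meson order_le_less_trans)
  then obtain l where l: "(\<lambda>n. scal_part (X n)) \<longlonglongrightarrow> l"
    by (auto simp: Cauchy_convergent_iff convergent_def)
  have "(\<lambda>n. norm ((scal_part (X n) - l) *\<^sub>C (1 :: 'a unitization))) \<longlonglongrightarrow> 0"
    using l by (simp add: norm_scaleC_unitization tendsto_norm_zero LIM_zero)
  then have "(\<lambda>n. (scal_part (X n) - l) *\<^sub>C (1 :: 'a unitization)) \<longlonglongrightarrow> 0"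
    by (rule tendsto_norm_zero_cancel)
  then have s: "(\<lambda>n. scal_part (X n) *\<^sub>C (1 :: 'a unitization)) \<longlonglongrightarrow> l *\<^sub>C 1"
    by (simp add: complex_vector.scale_left_diff_distrib LIM_zero_iff)
  have "norm (alg_part x) \<le> 2 * norm x" for x :: "'a unitization"
  proof -
    have "norm (to_unitization (alg_part x)) \<le> norm x + norm (scal_part x *\<^sub>C (1 :: 'a unitization))"
      using norm_triangle_ineq4[of x "scal_part x *\<^sub>C 1"] unitization_decomposition[of x]
      by (metis add_diff_cancel_right')
    then show ?thesis
      using le[of x] by (simp add: norm_scaleC_unitization)
  qed
  then have dist_le: "dist (alg_part x) (alg_part y) \<le> 2 * dist x y" for x y :: "'a unitization"
    by (simp add: dist_norm flip: minus_unitization.sel)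
  have "Cauchy (\<lambda>n. alg_part (X n))"
  proof (rule metric_CauchyI)
    fix e :: real
    assume "0 < e"
    then obtain M where "\<forall>m\<ge>M. \<forall>n\<ge>M. dist (X m) (X n) < e / 2"
      using metric_CauchyD[OF X, of "e / 2"] by auto
    then have "dist (alg_part (X m)) (alg_part (X n)) < e" if "m \<ge> M" "n \<ge> M" for m n
      using dist_le[of "X m" "X n"] that by fastforce
    then show "\<exists>M. \<forall>m\<ge>M. \<forall>n\<ge>M. dist (alg_part (X m)) (alg_part (X n)) < e"
      by blast
  qed
  then obtain a where a: "(\<lambda>n. alg_part (X n)) \<longlonglongrightarrow> a"
    by (auto simp: Cauchy_convergent_iff convergent_def)
  then have "(\<lambda>n. to_unitization (alg_part (X n))) \<longlonglongrightarrow> to_unitization a"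
    by (simp add: tendsto_iff dist_norm flip: to_unitization_simps)
  with s have "(\<lambda>n. to_unitization (alg_part (X n)) + scal_part (X n) *\<^sub>C 1) \<longlonglongrightarrow> to_unitization a + l *\<^sub>C 1"
    by (intro tendsto_add)
  then show "convergent X"
    by (auto simp: convergent_def simp flip: unitization_decomposition)
qed

instantiation unitization :: (cstar_algebra) unital_cstar_algebra
begin

primcorec star_unitization where
  "alg_part (star x) = star (alg_part x)"
| "scal_part (star x) = cnj (scal_part x)"

instance
proof
  fix x y :: "'a unitization" and c :: complex
  show "c *\<^sub>C x * y = c *\<^sub>C (x * y)" "x * c *\<^sub>C y = c *\<^sub>C (x * y)"
    by (simp_all add: unitization_eq_iff scaleC_add_right scaleC_scaleC mult_scaleC_left
        mult_scaleC_right mult_ac)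
  show "norm (c *\<^sub>C x) = cmod c * norm x"
    by (rule norm_scaleC_unitization)
  show "star (star x) = x" "star (x + y) = star x + star y" "star (c *\<^sub>C x) = cnj c *\<^sub>C star x"
    by (simp_all add: unitization_eq_iff star_star star_add star_scaleC)
  show "star (x * y) = star y * star x"
    by (simp add: unitization_eq_iff star_add star_scaleC star_mult add_ac)
  \<comment> \<open>The C*-identity of the algebra, applied to \<open>left_action z y\<close>,
    bounds its squared norm by \<open>norm y * norm (left_action (star z * z) y)\<close>; this
    controls the operator norm, and scalar parts satisfy equality.\<close>
  have le: "(norm z)\<^sup>2 \<le> norm (star z * z)" for z :: "'a unitization"
  proof -
    let ?N = "onorm (left_action (star z * z))"
    have "norm (left_action z y) \<le> sqrt ?N * norm y" for y
    proof -
      have "star (left_action z y) * left_action z y = star y * left_action (star z * z) y"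
        by (simp add: left_action_def star_add star_mult star_scaleC algebra_simps scaleC_add_right
            mult_scaleC_left mult_scaleC_right scaleC_scaleC)
      then have "(norm (left_action z y))\<^sup>2 \<le> norm y * norm (left_action (star z * z) y)"
        using norm_mult_ineq[of "star y" "left_action (star z * z) y"]
        by (simp flip: cstar_identity)
      also have "\<dots> \<le> norm y * (?N * norm y)"
        by (intro mult_left_mono onorm bounded_linear_left_action) simp
      finally have "norm (left_action z y) \<le> sqrt (?N * (norm y)\<^sup>2)"
        by (intro real_le_rsqrt) (simp add: power2_eq_square mult_ac)
      then show ?thesis by (simp add: real_sqrt_mult)
    qed
    then have "onorm (left_action z) \<le> sqrt ?N"
      by (intro onorm_bound) (simp_all add: onorm_pos_le bounded_linear_left_action)
    then have "(onorm (left_action z))\<^sup>2 \<le> ?N"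
      by (metis onorm_pos_le bounded_linear_left_action real_sqrt_le_iff real_sqrt_abs abs_of_nonneg)
    moreover have "(cmod (scal_part z))\<^sup>2 = cmod (scal_part (star z * z))"
      by (simp add: norm_mult power2_eq_square)
    ultimately show ?thesis
      by (auto simp: norm_unitization_def max_def)
  qed
  \<comment> \<open>As in the algebra itself, the inequality just proved makes \<open>star\<close>
    isometric, which gives the reverse bound.\<close>
  have norm_le: "norm z \<le> norm (star z)" for z :: "'a unitization"
  proof (cases "z = 0")
    case False
    have "(norm z)\<^sup>2 \<le> norm (star z) * norm z"
      using le[of z] norm_mult_ineq[of "star z" z] by simp
    then show ?thesis
      using False by (simp add: power2_eq_square)
  qed simp
  have "norm (star x) = norm x"
    using norm_le[of x] norm_le[of "star x"] \<open>star (star x) = x\<close> by simp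
  then show "norm (star x * x) = (norm x)\<^sup>2"
    using le[of x] norm_mult_ineq[of "star x" x] by (simp add: power2_eq_square)
qed

end

lemma star_to_unitization: "star (to_unitization a) = to_unitization (star a)"
  by (simp add: unitization_eq_iff)

section \<open>Positive elements\<close>

lemma positive_element_iff: "positive_element a \<longleftrightarrow> nonneg (to_unitization a)"
proof
  assume "positive_element a"
  then obtain y where "a = y * star y"
    by (auto simp: positive_element_def)
  then show "nonneg (to_unitization a)"
    using nonneg_star_mult_self[of "to_unitization (star y)"]
    by (simp add: star_to_unitization star_star to_unitization_simps)
next
  assume "nonneg (to_unitization a)"
  then obtain r where r: "nonneg r" "r * r = to_unitization a"
    using nonneg_sqrt by blast
  \<comment> \<open>The scalar part of the root squares to 0, so the root lies in the
    algebra.\<close>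
  have "scal_part r * scal_part r = 0" "alg_part (star r) = alg_part r"
    using r by (simp_all flip: times_unitization.sel add: nonneg_selfadjoint)
  then have "a = alg_part r * star (alg_part r)"
    using arg_cong[OF r(2), of alg_part] by simp
  then show "positive_element a"
    unfolding positive_element_def by blast
qed

lemma positive_element_selfadjoint: "positive_element a \<Longrightarrow> star a = a"
  by (auto simp: positive_element_def star_mult star_star)

lemma positive_element_star_mult_self: "positive_element (star x * x)"
  unfolding positive_element_def by (metis star_star)

lemma positive_element_zero: "positive_element 0"
  using positive_element_star_mult_self[of 0] by simp

lemma positive_element_add:
  "positive_element a \<Longrightarrow> positive_element b \<Longrightarrow> positive_element (a + b)"
  by (simp add: positive_element_iff to_unitization_simps nonneg_add)

lemma positive_element_scaleR:
  "positive_element a \<Longrightarrow> 0 \<le> c \<Longrightarrow> positive_element (c *\<^sub>R a)"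
  by (simp add: positive_element_iff to_unitization_simps nonneg_scaleR)

lemma positive_element_sum:
  "(\<And>i. i \<in> I \<Longrightarrow> positive_element (f i)) \<Longrightarrow> positive_element (sum f I)"
  by (induction I rule: infinite_finite_induct)
    (auto intro: positive_element_add simp: positive_element_zero)

lemma positive_element_antisym: "positive_element a \<Longrightarrow> positive_element (- a) \<Longrightarrow> a = 0"
  using nonneg_antisym[of "to_unitization a"] by (simp add: positive_element_iff to_unitization_simps)

lemma closed_positive_element: "closed {a :: 'a :: cstar_algebra. positive_element a}"
proof -
  have "bounded_linear (to_unitization :: 'a \<Rightarrow> 'a unitization)"
    by (rule bounded_linear_intro[where K = 1]) (simp_all add: to_unitization_simps)
  then have "isCont to_unitization (x :: 'a)" for x
    by (rule bounded_linear.isCont) simp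
  then have "closed (to_unitization -` {a :: 'a unitization. nonneg a})"
    by (intro continuous_closed_vimage closed_nonneg) simp
  then show ?thesis
    by (simp add: vimage_def positive_element_iff)
qed

text \<open>The scalar parts of the two components have difference and product zero, so the
  decomposition made in the unitization stays in the algebra.\<close>

lemma positive_element_jordan_decomposition:
  fixes h :: "'a :: cstar_algebra"
  assumes "star h = h"
  obtains p m where "positive_element p" "positive_element m" "h = p - m" "p * m = 0" "m * p = 0"
proof -
  have "star (to_unitization h) = to_unitization h"
    by (simp add: star_to_unitization assms)
  then obtain p m where pm: "nonneg p" "nonneg m" "to_unitization h = p - m" "p * m = 0" "m * p = 0"
    using jordan_decomposition by blast
  have "scal_part p - scal_part m = 0" "scal_part p * scal_part m = 0"
    by (simp_all flip: minus_unitization.sel times_unitization.sel pm(3) add: pm(4))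
  then have "scal_part p = 0" "scal_part m = 0"
    by auto
  then have "p = to_unitization (alg_part p)" "m = to_unitization (alg_part m)"
    by (simp_all add: unitization_eq_iff)
  then show ?thesis
    using pm that[of "alg_part p" "alg_part m"] positive_element_iff to_unitization_simps
    by (metis to_unitization_sel(1))
qed

text \<open>Sandwiching \<open>b = x * star x + z * star z\<close> between \<open>star y\<close> and
  \<open>y\<close> writes 0 as a sum of two positive elements, and the cone is proper.\<close>

lemma positive_element_mult_eq_0:
  fixes x y :: "'a :: cstar_algebra"
  assumes "positive_element (b - x * star x)" "b * y = 0"
  shows "star x * y = 0"
proof -
  obtain z where z: "b - x * star x = z * star z"
    using assms(1) by (auto simp: positive_element_def)
  have "(x * star x + z * star z) * y = 0"
    using assms(2) by (simp flip: z)
  then have "star y * ((x * star x + z * star z) * y) = 0"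
    by simp
  then have "star (star x * y) * (star x * y) + star (star z * y) * (star z * y) = 0"
    by (simp add: star_mult star_star algebra_simps)
  then have "- (star (star x * y) * (star x * y)) = star (star z * y) * (star z * y)"
    by (simp add: minus_unique)
  then have "star (star x * y) * (star x * y) = 0"
    by (intro positive_element_antisym) (simp_all add: positive_element_star_mult_self)
  then show ?thesis
    by (simp only: star_mult_self_eq_0_iff)
qed

text \<open>Taking adjoints moves an annihilator from the left of \<open>b\<close> to its
  right.\<close>

lemma zero_divisor_selfadjoint:
  assumes "star b = b" "zero_divisor b"
  obtains y where "y \<noteq> 0" "b * y = 0"
proof -
  obtain y where y: "y \<noteq> 0" "b * y = 0 \<or> y * b = 0"
    using assms(2) by (auto simp: zero_divisor_def)
  have "b * star y = 0" if "y * b = 0"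
    using arg_cong[OF that, of star] assms(1) by (simp add: star_mult)
  moreover have "star y \<noteq> 0"
    using y(1) by (metis star_star star_zero)
  ultimately show ?thesis
    using y that by blast
qed

section \<open>Orthogonal positive elements\<close>

text \<open>Divide by \<open>n\<close> and let \<open>n\<close> grow: closedness of the cone puts
  \<open>h\<close> in it and, from negative \<open>t\<close>, also \<open>- h\<close>.\<close>

lemma selfadjoint_eq_0_if_all_multiples_above:
  fixes h k :: "'a :: cstar_algebra"
  assumes "\<And>t. positive_element (t *\<^sub>R h - k)"
  shows "h = 0"
proof -
  have limit: "positive_element a" if "\<And>n. positive_element (real n *\<^sub>R a - k)" for a
  proof -
    have "(\<lambda>n. a - inverse (real (Suc n)) *\<^sub>R k) \<longlonglongrightarrow> a - 0 *\<^sub>R k"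
      by (intro tendsto_intros LIMSEQ_inverse_real_of_nat)
    moreover have "a - inverse (real (Suc n)) *\<^sub>R k \<in> {a. positive_element a}" for n
    proof -
      have "a - inverse (real (Suc n)) *\<^sub>R k = inverse (real (Suc n)) *\<^sub>R (real (Suc n) *\<^sub>R a - k)"
        by (simp add: scaleR_right_diff_distrib del: of_nat_Suc)
      then show ?thesis
        using that[of "Suc n"] by (simp add: positive_element_scaleR del: of_nat_Suc)
    qed
    ultimately show ?thesis
      using closed_sequentially[OF closed_positive_element] by fastforce
  qed
  show ?thesis
  proof (rule positive_element_antisym)
    show "positive_element h"
      by (rule limit) (rule assms)
    show "positive_element (- h)"
      by (rule limit) (use assms[of "- real n" for n] in simp)
  qed
qed

text \<open>
  If every selfadjoint element is positive or negative, the closed sets of \<open>t\<close> with \<open>k \<ge> t h\<close> and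
  with \<open>k \<le> t h\<close> cover the real line, and connectedness yields a \<open>t\<close> with \<open>k = t h\<close>.
\<close>

lemma selfadjoint_multiple:
  fixes h k :: "'a :: cstar_algebra"
  assumes total: "\<And>x :: 'a. star x = x \<Longrightarrow> positive_element x \<or> positive_element (- x)"
    and h: "star h = h" "h \<noteq> 0" and k: "star k = k"
  obtains t where "k = t *\<^sub>R h"
proof -
  let ?A = "{t. positive_element (k - t *\<^sub>R h)}" and ?B = "{t. positive_element (t *\<^sub>R h - k)}"
  have tot: "t \<in> ?A \<or> t \<in> ?B" for t
    using total[of "k - t *\<^sub>R h"] h k by (simp add: star_diff star_scaleR)
  have "closed ((\<lambda>t. k - t *\<^sub>R h) -` {a. positive_element a})"
    "closed ((\<lambda>t. t *\<^sub>R h - k) -` {a. positive_element a})"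
    by (intro continuous_closed_vimage closed_positive_element continuous_intros)+
  then have closed: "closed ?A" "closed ?B"
    by (simp_all add: vimage_def)
  have "?A \<noteq> {}"
  proof
    assume "?A = {}"
    then have "positive_element (t *\<^sub>R h - k)" for t
      using tot[of t] by blast
    then show False
      using selfadjoint_eq_0_if_all_multiples_above h by blast
  qed
  moreover have "?B \<noteq> {}"
  proof
    assume "?B = {}"
    then have "positive_element (k - (- t) *\<^sub>R h)" for t
      using tot[of "- t"] by blast
    then have "positive_element (t *\<^sub>R h - (- k))" for t
      by (simp add: add.commute)
    then show False
      using selfadjoint_eq_0_if_all_multiples_above h by blast
  qed
  ultimately have "?A \<inter> ?B \<noteq> {}"
    using connected_closedD[of UNIV ?A ?B] closed tot by auto
  then obtain t where "positive_element (k - t *\<^sub>R h)" "positive_element (- (k - t *\<^sub>R h))"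
    by auto
  then have "k - t *\<^sub>R h = 0"
    by (rule positive_element_antisym)
  then show ?thesis
    by (intro that[of t]) simp
qed

text \<open>Two distinct members of a basis that are multiples of one vector are proportional,
  contradicting independence.\<close>

lemma nontrivial_not_multiples:
  assumes "nontrivial TYPE('a :: cstar_algebra)"
  shows "\<not> (\<forall>x. \<exists>c. x = c *\<^sub>C (e :: 'a))"
proof
  assume mult: "\<forall>x. \<exists>c. x = c *\<^sub>C e"
  obtain B :: "'a set" where B: "complex_vector.independent B" "infinite B \<or> card B > 1"
    using assms by (auto simp: nontrivial_def)
  have "\<not> is_singleton B" "B \<noteq> {}"
    using B(2) by (auto simp: is_singleton_altdef)
  then obtain x y where xy: "x \<in> B" "y \<in> B" "x \<noteq> y"
    by (metis is_singletonI' all_not_in_conv)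
  obtain c d where cd: "x = c *\<^sub>C e" "y = d *\<^sub>C e"
    using mult by metis
  have "y \<noteq> 0"
    using B(1) xy(2) complex_vector.dependent_zero by blast
  then have "x = (c / d) *\<^sub>C y"
    unfolding cd by (cases "d = 0") (simp_all add: scaleC_scaleC)
  also have "\<dots> \<in> complex_vector.span (B - {x})"
    using xy by (intro complex_vector.span_scale complex_vector.span_base) auto
  finally show False
    using B(1) xy(1) complex_vector.dependent_def by blast
qed

theorem ex_orthogonal_positive_elements:
  assumes "nontrivial TYPE('a :: cstar_algebra)"
  shows "\<exists>a b :: 'a. a \<noteq> 0 \<and> b \<noteq> 0 \<and> positive_element a \<and> positive_element b \<and> a * b = 0 \<and> b * a = 0"
proof (rule ccontr)
  assume no: "\<not> ?thesis"
  have total: "positive_element x \<or> positive_element (- x)" if sa: "star x = x" for x :: 'a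
  proof -
    obtain p m where "positive_element p" "positive_element m" "x = p - m" "p * m = 0" "m * p = 0"
      using positive_element_jordan_decomposition[OF sa] by blast
    moreover from this have "p = 0 \<or> m = 0"
      using no by blast
    ultimately show ?thesis by auto
  qed
  \<comment> \<open>All selfadjoint elements are real multiples of any nonzero one,
    \<open>h\<close>, and they span the algebra over the complex numbers. If there is no such
    \<open>h\<close>, the algebra is zero.\<close>
  have "\<exists>e :: 'a. \<forall>x. \<exists>c. x = c *\<^sub>C e"
  proof (cases "\<exists>h :: 'a. star h = h \<and> h \<noteq> 0")
    case True
    then obtain h :: 'a where h: "star h = h" "h \<noteq> 0" by blast
    have "\<exists>c. x = c *\<^sub>C h" for x
    proof -
      obtain a b where ab: "star a = a" "star b = b" "x = a + \<i> *\<^sub>C b"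
        using selfadjoint_decomposition[of x] by blast
      obtain s t where st: "a = s *\<^sub>R h" "b = t *\<^sub>R h"
        using selfadjoint_multiple[OF total h] ab(1,2) by metis
      have "x = (complex_of_real s + \<i> * complex_of_real t) *\<^sub>C h"
        unfolding scaleC_add_left scaleC_scaleC[symmetric] scaleC_of_real st[symmetric] by (rule ab(3))
      then show ?thesis ..
    qed
    then show ?thesis by blast
  next
    case False
    have "x = 0 *\<^sub>C 0" for x :: 'a
    proof -
      obtain a b where ab: "star a = a" "star b = b" "x = a + \<i> *\<^sub>C b"
        using selfadjoint_decomposition[of x] by blast
      then have "a = 0" "b = 0"
        using False by blast+
      then show ?thesis
        using ab(3) by simp
    qed
    then show ?thesis by blast
  qed
  then show False
    using nontrivial_not_multiples[OF assms] by blast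
qed

section \<open>Zero divisors and the order\<close>

theorem zero_divisor_of_positive_le:
  assumes "positive_element a" "a \<preceq> b" "zero_divisor b"
  shows "zero_divisor a"
proof -
  obtain x where x: "a = x * star x"
    using assms(1) by (auto simp: positive_element_def)
  \<comment> \<open>As a sum of positive elements \<open>b\<close> is selfadjoint, so its
    annihilator may be taken on the right.\<close>
  have "positive_element ((b - a) + a)"
    using assms unfolding cstar_le_def by (intro positive_element_add)
  then have "star b = b"
    by (simp add: positive_element_selfadjoint)
  then obtain y where y: "y \<noteq> 0" "b * y = 0"
    using zero_divisor_selfadjoint assms(3) by blast
  have "star x * y = 0"
    using positive_element_mult_eq_0[of b x y] assms(2) y(2) by (simp add: cstar_le_def x)
  then have "a * y = 0"
    by (simp add: x mult.assoc)
  then show ?thesis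
    using y(1) by (auto simp: zero_divisor_def)
qed

text \<open>
  For a dense sequence \<open>x\<close>, the sum of suitably scaled \<open>x\<^sub>n x\<^sub>n\<^sup>*\<close> dominates each of its terms, so that
  an element annihilated by it is annihilated by all \<open>x\<^sub>n\<^sup>*\<close>, hence by its own adjoint.
\<close>

theorem ex_positive_element_right_regular:
  assumes "separable_space (euclidean :: 'a :: cstar_algebra topology)"
  obtains a :: "'a :: cstar_algebra" where "positive_element a" "\<And>y. a * y = 0 \<Longrightarrow> y = 0"
proof -
  obtain C :: "'a set" where C: "countable C" "closure C = UNIV"
    using assms by (auto simp: separable_space_def)
  then have "C \<noteq> {}" by auto
  define x where "x = from_nat_into C"
  \<comment> \<open>These weights give \<open>norm (f n) \<le> (1/2) ^ n\<close>; the summand 1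
    keeps the denominator positive when \<open>x n = 0\<close>.\<close>
  define w where "w n = (1/2) ^ n / (1 + (norm (x n))\<^sup>2)" for n
  define f where "f n = w n *\<^sub>R (x n * star (x n))" for n
  have pos: "1 + (norm (x n))\<^sup>2 > 0" for n
    by (simp add: add_pos_nonneg)
  have w: "w n > 0" for n
    unfolding w_def using pos by simp
  have f_pos: "positive_element (f n)" for n
    unfolding f_def using w[of n] by (intro positive_element_scaleR) (auto simp: positive_element_def)
  have bound: "norm (f n) \<le> (1/2) ^ n" for n
  proof -
    have "norm (x n * star (x n)) \<le> 1 + (norm (x n))\<^sup>2"
      using norm_mult_ineq[of "x n" "star (x n)"] by (simp add: power2_eq_square)
    then have "norm (f n) \<le> w n * (1 + (norm (x n))\<^sup>2)"
      unfolding f_def using w[of n] by (simp add: mult_left_mono)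
    also have "\<dots> = (1/2) ^ n"
      unfolding w_def using pos[of n] by simp
    finally show ?thesis .
  qed
  have "summable f"
    by (rule summable_comparison_test'[OF _ bound]) (simp add: summable_geometric)
  then have lim: "(\<lambda>N. sum f {..<N}) \<longlonglongrightarrow> suminf f"
    by (rule summable_LIMSEQ)
  have dom: "positive_element (suminf f - f n)" for n
  proof -
    have lim_diff: "(\<lambda>N. sum f {..<N} - f n) \<longlonglongrightarrow> suminf f - f n"
      by (intro tendsto_intros lim)
    \<comment> \<open>Once \<open>N > n\<close>, removing \<open>f n\<close> leaves a finite sum of
      positive elements; closedness passes this to the limit.\<close>
    have "\<forall>\<^sub>F N in sequentially. sum f {..<N} - f n \<in> {a. positive_element a}"
      using eventually_gt_at_top[of n]
    proof eventually_elim
      case (elim N)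
      then have "sum f {..<N} - f n = sum f ({..<N} - {n})"
        by (simp add: sum_diff1)
      then show ?case
        by (simp add: positive_element_sum f_pos)
    qed
    then show ?thesis
      using Lim_in_closed_set[OF closed_positive_element _ sequentially_bot lim_diff] by simp
  qed
  show ?thesis
  proof (rule that[of "suminf f"])
    show "positive_element (suminf f)"
      using positive_element_add[OF dom[of 0] f_pos[of 0]] by simp
    fix y assume y: "suminf f * y = 0"
    have "star (x n) * y = 0" for n
    proof -
      \<comment> \<open>The weight is absorbed into the vector so that \<open>f n\<close> has the
        form \<open>x * star x\<close>.\<close>
      have "f n = (sqrt (w n) *\<^sub>R x n) * star (sqrt (w n) *\<^sub>R x n)"
        using w[of n] by (simp add: f_def star_scaleR)
      then have "star (sqrt (w n) *\<^sub>R x n) * y = 0"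
        using dom[of n] y positive_element_mult_eq_0[of "suminf f" "sqrt (w n) *\<^sub>R x n" y] by simp
      then show ?thesis
        using w[of n] by (simp add: star_scaleR)
    qed
    then have "C \<subseteq> {z. star z * y = 0}"
      unfolding x_def using from_nat_into_surj[OF C(1)] by fastforce
    moreover have "closed {z. star z * y = 0}"
      by (intro closed_Collect_eq continuous_on_mult continuous_on_const
          linear_continuous_on bounded_linear_star)
    ultimately have "closure C \<subseteq> {z. star z * y = 0}"
      by (rule closure_minimal)
    \<comment> \<open>By density the closed set is everything; membership of \<open>y\<close> itself
      reads \<open>star y * y = 0\<close>.\<close>
    then have "y \<in> {z. star z * y = 0}"
      unfolding C(2) by (rule subsetD) (rule UNIV_I)
    then show "y = 0" by simp
  qed
qed

theorem theorem1:
  assumes "nontrivial TYPE('a :: cstar_algebra)"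
  shows "(\<exists>a b :: 'a. a \<noteq> 0 \<and> b \<noteq> 0 \<and> positive_element a \<and> positive_element b \<and> a * b = 0 \<and> b * a = 0)
    \<and> (\<forall>a b :: 'a. positive_element a \<and> 0 \<preceq> a \<and> a \<preceq> b \<and> zero_divisor b \<longrightarrow> zero_divisor a)
    \<and> ((\<forall>x y :: 'a. x * y = y * x) \<and> separable_space (euclidean :: 'a topology)
         \<longrightarrow> (\<exists>a :: 'a. positive_element a \<and> \<not> zero_divisor a))"
proof (intro conjI allI impI)
  show "\<exists>a b :: 'a. a \<noteq> 0 \<and> b \<noteq> 0 \<and> positive_element a \<and> positive_element b \<and> a * b = 0 \<and> b * a = 0"
    using assms by (rule ex_orthogonal_positive_elements)
next
  fix a b :: 'a
  assume "positive_element a \<and> 0 \<preceq> a \<and> a \<preceq> b \<and> zero_divisor b"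
  then show "zero_divisor a"
    using zero_divisor_of_positive_le by blast
next
  assume *: "(\<forall>x y :: 'a. x * y = y * x) \<and> separable_space (euclidean :: 'a topology)"
  then obtain a :: 'a where a: "positive_element a" "\<And>y. a * y = 0 \<Longrightarrow> y = 0"
    using ex_positive_element_right_regular by blast
  \<comment> \<open>Commutativity turns a left annihilator of \<open>a\<close> into a right
    one.\<close>
  have "\<not> zero_divisor a"
    using a(2) * unfolding zero_divisor_def by metis
  with a(1) show "\<exists>a :: 'a. positive_element a \<and> \<not> zero_divisor a"
    by blast
qed

end
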